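(* For any three distinct natural numbers $a,b,c$, there exists a $2$-coloring $\phi:\mathbb{N}\to\{1,2\}$ such that for any $i\in\{1,2\}$ and any $n\in\mathbb{N}$, the set $$\{m\in\mathbb{N}:\phi(n+am)=\phi(n+bm)=\phi(n+cm)=i\}$$ is empty or finite.
   Context: $\mathbb{N}=\{1,2,3,\ldots\}$ is the set of natural numbers. *)

theory Defs
  imports Complex_Main "HOL-Library.FuncSet"
begin

text \<open>The natural numbers start at 1 here, unlike the type \<^typ>\<open>nat\<close>.\<close>

abbreviation pos_nats :: "nat set" where
  "pos_nats \<equiv> {1..}"

end

theory Submission
  imports Defs
begin

text \<open>
  Suppose \<open>a < b < c\<close>.  On a logarithmic scale the multiples \<open>a * m\<close>, \<open>b * m\<close>, \<open>c * m\<close> form a rigid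
  pattern with gaps \<open>ln (b/a)\<close> and \<open>ln (c/b)\<close>.  Cut the logarithmic line into consecutive intervals
  whose length is the larger gap, and colour them alternately.  The total length \<open>ln (c/a)\<close> of the
  pattern exceeds the interval length, so the outer two points lie in different intervals.  Since
  each gap advances by at most one interval, these intervals are either neighbours, and then the
  outer points differ in colour, or they are separated by one interval of the other colour, and
  this interval contains the middle point.

  Adding \<open>n\<close> to all three points shortens the gaps.  The upper bounds on the single gaps therefore
  persist, and the lower bound on the total length, being strict, persists as soon as \<open>m\<close> is large
  (\<open>finite_monochromatic_sorted\<close>).
\<close>

definition log_interval :: "real \<Rightarrow> nat \<Rightarrow> int" where
  "log_interval R x = \<lfloor>log R (real x)\<rfloor>"

definition log_parity_colouring :: "real \<Rightarrow> nat \<Rightarrow> nat" where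
  "log_parity_colouring R x = (if even (log_interval R x) then 1 else 2)"

lemma log_interval_mono:
  assumes "R > 1" "0 < x" "x \<le> y"
  shows "log_interval R x \<le> log_interval R y"
  using assms by (auto simp: log_interval_def intro!: floor_mono)

lemma log_interval_times_base:
  assumes "R > 1" "0 < x"
  shows "\<lfloor>log R (R * real x)\<rfloor> = log_interval R x + 1"
  using assms by (simp add: log_interval_def log_mult)

lemma log_interval_le_Suc:
  assumes "R > 1" "0 < x" "0 < y" "real y \<le> R * real x"
  shows "log_interval R y \<le> log_interval R x + 1"
proof -
  have "log R (real y) \<le> log R (R * real x)"
    using assms by simp
  then show ?thesis
    using log_interval_times_base[OF assms(1,2)] floor_mono unfolding log_interval_def by metis
qed

lemma log_interval_ge_Suc:
  assumes "R > 1" "0 < x" "R * real x \<le> real y"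
  shows "log_interval R x + 1 \<le> log_interval R y"
proof -
  have "0 < R * real x"
    using assms by simp
  then have "log R (R * real x) \<le> log R (real y)"
    using assms by (intro log_mono) auto
  then show ?thesis
    using log_interval_times_base[OF assms(1,2)] floor_mono unfolding log_interval_def by metis
qed

text \<open>The interval numbers of \<open>x\<close>, \<open>y\<close>, \<open>z\<close> rise by at most one at each step and by at least one
  in total, so some step rises by exactly one and changes the parity.\<close>

lemma log_parity_colouring_not_monochromatic:
  assumes "R > 1" "0 < x" "x \<le> y" "y \<le> z"
    and "real y \<le> R * real x" "real z \<le> R * real y" "R * real x \<le> real z"
  shows "\<not> (log_parity_colouring R x = i \<and> log_parity_colouring R y = i \<and>
            log_parity_colouring R z = i)"
proof -
  have "log_interval R x \<le> log_interval R y" "log_interval R y \<le> log_interval R z"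
    using assms by (auto intro!: log_interval_mono)
  moreover have "log_interval R y \<le> log_interval R x + 1" "log_interval R z \<le> log_interval R y + 1"
    using assms by (auto intro!: log_interval_le_Suc)
  moreover have "log_interval R x + 1 \<le> log_interval R z"
    using assms by (auto intro!: log_interval_ge_Suc)
  ultimately have "log_interval R y = log_interval R x + 1 \<or>
      log_interval R z = log_interval R y + 1"
    by linarith
  then show ?thesis
    by (auto simp: log_parity_colouring_def split: if_splits)
qed

lemma shifted_multiple_le:
  fixes a b n m :: nat
  assumes "R \<ge> 1" "real b \<le> R * real a"
  shows "real (n + b * m) \<le> R * real (n + a * m)"
proof -
  have "real n \<le> R * real n"
    using assms(1) by (simp add: mult_le_cancel_right1)
  moreover have "real b * real m \<le> (R * real a) * real m"
    using assms(2) by (intro mult_right_mono) auto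
  ultimately show ?thesis
    by (simp add: algebra_simps)
qed

lemma finite_monochromatic_sorted:
  fixes a b c n i :: nat
  assumes "0 < a" "a < b" "b < c"
  defines "R \<equiv> max (real b / real a) (real c / real b)"
  shows "finite {m \<in> pos_nats. \<forall>d \<in> {a, b, c}. log_parity_colouring R (n + d * m) = i}"
proof -
  have R1: "R > 1"
    using assms by (simp add: R_def less_max_iff_disj)
  have "real b / real a \<le> R" "real c / real b \<le> R"
    by (simp_all add: R_def)
  then have ba: "real b \<le> R * real a" and cb: "real c \<le> R * real b"
    using assms(1-3) by (simp_all add: field_simps)
  \<comment> \<open>\<open>c/a\<close> is the product of the two ratios, both of which exceed 1.\<close>
  have gap: "R * real a < real c"
    using assms(1-3) by (auto simp: R_def max_def field_simps)
  \<comment> \<open>Solving \<open>R * (n + a * m) \<le> n + c * m\<close> for \<open>m\<close> gives the bound.\<close>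
  define B where "B = (R - 1) * real n / (real c - R * real a)"
  have "m < nat \<lceil>B\<rceil>"
    if m: "m \<in> pos_nats" "\<forall>d \<in> {a, b, c}. log_parity_colouring R (n + d * m) = i" for m
  proof (rule ccontr)
    assume "\<not> m < nat \<lceil>B\<rceil>"
    then have "B \<le> real m"
      by linarith
    then have "(R - 1) * real n \<le> real m * (real c - R * real a)"
      using gap by (simp add: B_def pos_divide_le_eq)
    then have "R * real (n + a * m) \<le> real (n + c * m)"
      by (simp add: algebra_simps)
    moreover have "real (n + b * m) \<le> R * real (n + a * m)" "real (n + c * m) \<le> R * real (n + b * m)"
      using R1 ba cb by (intro shifted_multiple_le; simp)+
    moreover have "0 < n + a * m" "n + a * m \<le> n + b * m" "n + b * m \<le> n + c * m"
      using m(1) assms(1-3) by auto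
    ultimately show False
      using log_parity_colouring_not_monochromatic[OF R1, of "n + a * m" "n + b * m" "n + c * m" i]
        m(2) by simp
  qed
  then have "{m \<in> pos_nats. \<forall>d \<in> {a, b, c}. log_parity_colouring R (n + d * m) = i}
      \<subseteq> {..<nat \<lceil>B\<rceil>}"
    by blast
  then show ?thesis
    by (rule finite_subset) simp
qed

lemma sorted_enumeration_of_three:
  fixes a b c :: "'a :: linorder"
  assumes "a \<noteq> b" "a \<noteq> c" "b \<noteq> c"
  obtains x y z where "x < y" "y < z" "{a, b, c} = {x, y, z}"
proof -
  consider "a < b" "b < c" | "a < c" "c < b" | "b < a" "a < c" | "b < c" "c < a"
    | "c < a" "a < b" | "c < b" "b < a"
    using assms by (metis linorder_neqE)
  then show thesis
  proof cases
    case 1 then show thesis by (rule that) auto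
  next
    case 2 then show thesis by (rule that) auto
  next
    case 3 then show thesis by (rule that) auto
  next
    case 4 then show thesis by (rule that) auto
  next
    case 5 then show thesis by (rule that) auto
  next
    case 6 then show thesis by (rule that) auto
  qed
qed

theorem proposition1p6:
  fixes a b c :: nat
  assumes "a \<in> pos_nats" and "b \<in> pos_nats" and "c \<in> pos_nats"
    and "a \<noteq> b" and "a \<noteq> c" and "b \<noteq> c"
  shows "\<exists>\<phi> \<in> pos_nats \<rightarrow> {1, 2 :: nat}. \<forall>i \<in> {1, 2}. \<forall>n \<in> pos_nats.
    finite {m \<in> pos_nats. \<phi> (n + a * m) = i \<and> \<phi> (n + b * m) = i \<and> \<phi> (n + c * m) = i}"
proof -
  obtain x y z where xyz: "x < y" "y < z" "{a, b, c} = {x, y, z}"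
    using sorted_enumeration_of_three assms(4-6) by metis
  then have "x \<in> {a, b, c}"
    by blast
  then have "0 < x"
    using assms(1-3) by auto
  define \<phi> where "\<phi> = log_parity_colouring (max (real y / real x) (real z / real y))"
  have "finite {m \<in> pos_nats. \<forall>d \<in> {a, b, c}. \<phi> (n + d * m) = i}" for n i
    unfolding \<phi>_def xyz(3) using \<open>0 < x\<close> xyz(1,2) by (rule finite_monochromatic_sorted)
  moreover have "\<phi> \<in> pos_nats \<rightarrow> {1, 2}"
    by (auto simp: \<phi>_def log_parity_colouring_def)
  ultimately show ?thesis
    by (intro bexI[of _ \<phi>]) simp_all
qed

end
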